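(* Let $(X,\mathcal B)$ be a measurable space and let $\{P^x\}_{x\in X}$ be a discrete-time temporally-homogeneous Markov process with state space $(X,\mathcal B)$ and transition function $p(x,E)$. Suppose that $\{P^x\}_{x\in X}$ is conservative, i.e. $p(x,X)=1$ for every $x\in X$. Let $\mathcal I$ be the set of all invariant measures and $\mathcal R$ the set of all reversible measures of the process, and let $\mathcal I_e$ and $\mathcal R_e$ be the sets of all extreme elements of $\mathcal I$ and $\mathcal R$, respectively. Then $\mathcal R_e\subset\mathcal I_e$.
   Context: The transition function is $p(x,E):=P^x(\eta(1)\in E)$ for $x\in X$, $E\in\mathcal B$, where $\eta(1)$ is the position of the process at time $1$; for each $x$, $E\mapsto p(x,E)$ is a measure on $(X,\mathcal B)$ with $p(x,X)\le 1$, and for each $E\in\mathcal B$, $x\mapsto p(x,E)$ is $\mathcal B$-measurable. No topological assumption is made on $(X,\mathcal B)$. For a bounded $\mathcal B$-measurable function $f:X\to\mathbb R$ define $(Tf)(x):=\int_{y\in X}f(y)\,p(x,dy)$. A probability measure $m$ on $(X,\mathcal B)$ is an invariant measure if and only if $\int_X (Tf)(x)\,m(dx)=\int_X f(x)\,m(dx)$ for all bounded $\mathcal B$-measurable $f:X\to\mathbb R$. It is a reversible measure if and only if $\int_X (Tf)(x)g(x)\,m(dx)=\int_X f(x)(Tg)(x)\,m(dx)$ for all bounded $\mathcal B$-measurable $f,g:X\to\mathbb R$. For a subset $C$ of the set of all probability measures on $(X,\mathcal B)$, an element $m\in C$ is an extreme element of $C$ if and only if whenever $t\in(0,1)$, $m_0,m_1\in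 C$ and $m=(1-t)m_0+tm_1$, one has $m_0=m_1$. *)

theory Defs
  imports "HOL-Probability.Probability"
begin

text \<open>
  The state space is the measurable space carried by \<open>M\<close> (only \<open>space M\<close> and \<open>sets M\<close> matter).
  A process that need not be conservative may leave it; \<open>None\<close> is the cemetery.
  The events \<open>Some ` E\<close> suffice as generators, since \<open>{None}\<close> is the complement of
  \<open>Some ` space M\<close>.
\<close>

definition with_cemetery :: "'a measure \<Rightarrow> 'a option measure" where
  "with_cemetery M = sigma (insert None (Some ` space M)) ((`) Some ` sets M)"

text \<open>The measure \<open>p(x, E) = P\<^sup>x(\<eta>(1) \<in> E)\<close>.\<close>

definition transition ::
    "'a measure \<Rightarrow> ('a \<Rightarrow> 'w measure) \<Rightarrow> (nat \<Rightarrow> 'w \<Rightarrow> 'a option) \<Rightarrow> 'a \<Rightarrow> 'a measure" where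
  "transition M P \<eta> x =
     measure_of (space M) (sets M) (\<lambda>E. emeasure (P x) {\<omega> \<in> space (P x). \<eta> 1 \<omega> \<in> Some ` E})"

text \<open>
  The initial condition is stated on events because singletons of the state space need not be
  measurable.  The Markov property is \<open>P\<^sup>x(\<eta>(n+1) \<in> E | \<sigma>(\<eta>(0), \<dots>, \<eta>(n))) = p(\<eta>(n), E)\<close>,
  written out on the events \<open>A\<close> of the past, with \<open>p(None, E) = 0\<close>.  The sample space \<open>W\<close>
  is arbitrary and not assumed to be the canonical path space.
\<close>

locale markov_process =
  fixes M :: "'a measure" and W :: "'w measure"
    and P :: "'a \<Rightarrow> 'w measure" and \<eta> :: "nat \<Rightarrow> 'w \<Rightarrow> 'a option"
  assumes prob_space_P: "x \<in> space M \<Longrightarrow> prob_space (P x)"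
    and sets_P: "x \<in> space M \<Longrightarrow> sets (P x) = sets W"
    and measurable_position: "\<eta> n \<in> measurable W (with_cemetery M)"
    and start: "\<lbrakk>x \<in> space M; E \<in> sets M\<rbrakk> \<Longrightarrow>
      emeasure (P x) {\<omega> \<in> space W. \<eta> 0 \<omega> \<in> Some ` E} = indicator E x"
    and measurable_transition: "E \<in> sets M \<Longrightarrow>
      (\<lambda>x. emeasure (transition M P \<eta> x) E) \<in> borel_measurable M"
    and markov: "\<lbrakk>x \<in> space M; E \<in> sets M;
      A \<in> sigma_sets (space W) {\<eta> i -` B \<inter> space W | i B. i \<le> n \<and> B \<in> sets (with_cemetery M)}\<rbrakk> \<Longrightarrow>
      emeasure (P x) (A \<inter> {\<omega> \<in> space W. \<eta> (Suc n) \<omega> \<in> Some ` E}) =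
      (\<integral>\<^sup>+\<omega>\<in>A. (case \<eta> n \<omega> of None \<Rightarrow> 0 | Some y \<Rightarrow> emeasure (transition M P \<eta> y) E) \<partial>P x)"

text \<open>In the following, \<open>p\<close> is a transition function: \<open>p x\<close> is the measure \<open>p(x, \<cdot>)\<close>.\<close>

definition conservative :: "'a measure \<Rightarrow> ('a \<Rightarrow> 'a measure) \<Rightarrow> bool" where
  "conservative M p \<longleftrightarrow> (\<forall>x\<in>space M. emeasure (p x) (space M) = 1)"

definition bounded_measurable :: "'a measure \<Rightarrow> ('a \<Rightarrow> real) set" where
  "bounded_measurable M = {f \<in> borel_measurable M. \<exists>c. \<forall>x\<in>space M. \<bar>f x\<bar> \<le> c}"

definition transition_op :: "('a \<Rightarrow> 'a measure) \<Rightarrow> ('a \<Rightarrow> real) \<Rightarrow> 'a \<Rightarrow> real" where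
  "transition_op p f x = (\<integral>y. f y \<partial>p x)"

definition prob_measures :: "'a measure \<Rightarrow> 'a measure set" where
  "prob_measures M = {m. prob_space m \<and> sets m = sets M}"

definition invariant_measures :: "'a measure \<Rightarrow> ('a \<Rightarrow> 'a measure) \<Rightarrow> 'a measure set" where
  "invariant_measures M p = {m \<in> prob_measures M. \<forall>f\<in>bounded_measurable M.
     (\<integral>x. transition_op p f x \<partial>m) = (\<integral>x. f x \<partial>m)}"

definition reversible_measures :: "'a measure \<Rightarrow> ('a \<Rightarrow> 'a measure) \<Rightarrow> 'a measure set" where
  "reversible_measures M p = {m \<in> prob_measures M.
     \<forall>f\<in>bounded_measurable M. \<forall>g\<in>bounded_measurable M.
       (\<integral>x. transition_op p f x * g x \<partial>m) = (\<integral>x. f x * transition_op p g x \<partial>m)}"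

definition extreme_elements :: "'a measure \<Rightarrow> 'a measure set \<Rightarrow> 'a measure set" where
  "extreme_elements M C = {m \<in> C. \<forall>t::real. \<forall>m0\<in>C. \<forall>m1\<in>C.
     0 < t \<longrightarrow> t < 1 \<longrightarrow>
     (\<forall>E\<in>sets M. measure m E = (1 - t) * measure m0 E + t * measure m1 E) \<longrightarrow> m0 = m1}"

context markov_process
begin

lemma space_P: "x \<in> space M \<Longrightarrow> space (P x) = space W"
  using sets_P by (rule sets_eq_imp_space_eq)

lemma sets_transition [simp]: "sets (transition M P \<eta> x) = sets M"
  and space_transition [simp]: "space (transition M P \<eta> x) = space M"
  by (simp_all add: transition_def)

lemma position_event:
  assumes "E \<in> sets M"
  shows "{\<omega> \<in> space W. \<eta> n \<omega> \<in> Some ` E} \<in> sets W"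
proof -
  have gen: "(`) Some ` sets M \<subseteq> Pow (insert None (Some ` space M))"
    using sets.sets_into_space by fastforce
  have "Some ` E \<in> sets (with_cemetery M)"
    unfolding with_cemetery_def using assms gen by (auto simp: sets_measure_of)
  from measurable_sets[OF measurable_position this, of n] show ?thesis
    by (simp add: vimage_def Int_def conj_commute)
qed

lemma emeasure_transition:
  assumes x: "x \<in> space M" and E: "E \<in> sets M"
  shows "emeasure (transition M P \<eta> x) E = emeasure (P x) {\<omega> \<in> space W. \<eta> 1 \<omega> \<in> Some ` E}"
proof -
  let ?\<mu> = "\<lambda>E. emeasure (P x) {\<omega> \<in> space (P x). \<eta> 1 \<omega> \<in> Some ` E}"
  have "countably_additive (sets M) ?\<mu>"
  proof (rule countably_additiveI)
    fix A :: "nat \<Rightarrow> 'a set"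
    assume A: "range A \<subseteq> sets M" "disjoint_family A"
    have "(\<Sum>i. ?\<mu> (A i)) = emeasure (P x) (\<Union>i. {\<omega> \<in> space (P x). \<eta> 1 \<omega> \<in> Some ` A i})"
    proof (rule suminf_emeasure)
      show "range (\<lambda>i. {\<omega> \<in> space (P x). \<eta> 1 \<omega> \<in> Some ` A i}) \<subseteq> sets (P x)"
        using A(1) position_event[of _ 1] by (auto simp: sets_P[OF x] space_P[OF x])
      show "disjoint_family (\<lambda>i. {\<omega> \<in> space (P x). \<eta> 1 \<omega> \<in> Some ` A i})"
        using A(2) by (fastforce simp: disjoint_family_on_def)
    qed
    also have "(\<Union>i. {\<omega> \<in> space (P x). \<eta> 1 \<omega> \<in> Some ` A i}) =
        {\<omega> \<in> space (P x). \<eta> 1 \<omega> \<in> Some ` (\<Union>i. A i)}"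
      by auto
    finally show "(\<Sum>i. ?\<mu> (A i)) = ?\<mu> (\<Union>i. A i)" .
  qed
  moreover have "positive (sets M) ?\<mu>"
    by (simp add: positive_def)
  ultimately show ?thesis
    unfolding transition_def using E
    by (subst emeasure_measure_of_sigma) (auto simp: sets.sigma_algebra_axioms space_P[OF x])
qed

end

end

theory Submission
  imports Defs
begin

text \<open>
  A reversible measure is invariant, because a conservative transition operator \<open>T\<close> fixes the
  constant \<open>1\<close>.  So the point is extremality: if a reversible \<open>m\<close>, extreme among the reversible
  measures, is a proper convex combination of invariant \<open>m0\<close> and \<open>m1\<close>, then \<open>m0 = m1\<close>.  This follows
  once \<open>m0\<close> and \<open>m1\<close> are known to be reversible themselves.

  Both are dominated by a multiple of \<open>m\<close>, so each is \<open>h m\<close> with a bounded density \<open>h\<close>.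
  Invariance of \<open>m\<close> gives \<open>\<integral> T(h\<^sup>2) \<partial>m = \<integral> h\<^sup>2 \<partial>m\<close>, and invariance of \<open>h m\<close>, tested on \<open>h\<close>,
  gives \<open>\<integral> h \<cdot> Th \<partial>m = \<integral> h\<^sup>2 \<partial>m\<close>.  Hence the Dirichlet form
  \<open>\<integral>\<integral> (h y - h x)\<^sup>2 p(x, dy) m(dx) = \<integral> T(h\<^sup>2) - 2 h \<cdot> Th + h\<^sup>2 \<partial>m\<close>
  vanishes (lemma \<open>invariant_density_constant_along_transitions\<close>): almost surely the process
  does not change the value of \<open>h\<close>.  Therefore \<open>T(h g) = h \<cdot> Tg\<close> almost everywhere, which carries the symmetry of
  \<open>T\<close> over from \<open>m\<close> to \<open>h m\<close> (lemma \<open>invariant_dominated_by_reversible\<close>).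
\<close>

section \<open>Bounded densities\<close>

lemma bounded_density_exists:
  assumes "finite_measure m" "finite_measure n" and sets: "sets n = sets m" and c: "0 \<le> c"
    and dom: "\<And>E. E \<in> sets m \<Longrightarrow> measure n E \<le> c * measure m E"
  obtains h :: "'a \<Rightarrow> real" where "h \<in> borel_measurable m" "\<And>x. 0 \<le> h x" "\<And>x. h x \<le> c"
    "n = density m (\<lambda>x. ennreal (h x))"
proof -
  interpret m: finite_measure m by fact
  interpret n: finite_measure n by fact
  have edom: "emeasure n E \<le> ennreal c * emeasure m E" if "E \<in> sets m" for E
    using dom[OF that] c
    by (simp add: m.emeasure_eq_measure n.emeasure_eq_measure flip: ennreal_mult)
  have "absolutely_continuous m n"
    unfolding absolutely_continuous_def
  proof
    fix E assume E: "E \<in> null_sets m"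
    then have "emeasure n E \<le> 0" using edom[of E] by (auto simp: null_sets_def)
    then show "E \<in> null_sets n" using E sets by (auto simp: null_sets_def)
  qed
  then obtain f where f [measurable]: "f \<in> borel_measurable m" and n: "density m f = n"
    using m.Radon_Nikodym[OF _ sets] by auto
  \<comment> \<open>The excess of \<open>f\<close> over \<open>c\<close> has integral zero, because \<open>n E \<le> c \<cdot> m E\<close> for \<open>E = {f > c}\<close>.\<close>
  define E where "E = {x \<in> space m. ennreal c < f x}"
  have E [measurable]: "E \<in> sets m" unfolding E_def by measurable
  have "(\<integral>\<^sup>+x. f x - c \<partial>m) + ennreal c * emeasure m E
      = (\<integral>\<^sup>+x. (f x - c) + ennreal c * indicator E x \<partial>m)"
    by (subst nn_integral_add) (auto simp: nn_integral_cmult_indicator)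
  also have "\<dots> = (\<integral>\<^sup>+x. f x * indicator E x \<partial>m)"
    by (intro nn_integral_cong)
      (auto simp: E_def indicator_def not_less diff_eq_0_iff_ennreal
        intro!: diff_add_cancel_ennreal intro: le_less_trans[OF _ ennreal_less_top])
  also have "\<dots> = emeasure n E" by (simp add: n[symmetric] emeasure_density)
  also have "\<dots> \<le> 0 + ennreal c * emeasure m E" using edom[OF E] by simp
  finally have "(\<integral>\<^sup>+x. f x - c \<partial>m) = 0"
    by (subst (asm) ennreal_add_left_cancel_le[of "_ * _", unfolded add.commute[of "_ * _"]])
       (auto simp: ennreal_mult_eq_top_iff)
  then have AE: "AE x in m. f x \<le> c"
    by (subst (asm) nn_integral_0_iff_AE) (auto simp: diff_eq_0_iff_ennreal elim!: eventually_mono)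
  define h where "h x = enn2real (min (f x) c)" for x
  have "n = density m (\<lambda>x. ennreal (h x))"
    unfolding n[symmetric]
  proof (rule density_cong)
    show "AE x in m. f x = ennreal (h x)"
      using AE
    proof eventually_elim
      case (elim x)
      then have "f x < \<top>" by (rule le_less_trans) simp
      with elim show ?case by (simp add: h_def min_def)
    qed
  qed (auto simp: h_def)
  moreover have "h x \<le> c" for x
    unfolding h_def using c by (intro enn2real_leI) auto
  ultimately show ?thesis using that[of h] by (auto simp: h_def[abs_def])
qed

section \<open>Bounded measurable functions and the transition operator\<close>

lemma bounded_measurable_mult:
  assumes "f \<in> bounded_measurable M" "g \<in> bounded_measurable M"
  shows "(\<lambda>x. f x * g x) \<in> bounded_measurable M"
proof -
  obtain a b where "\<And>x. x \<in> space M \<Longrightarrow> \<bar>f x\<bar> \<le> a" "\<And>x. x \<in> space M \<Longrightarrow> \<bar>g x\<bar> \<le> b"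
    using assms by (auto simp: bounded_measurable_def)
  then have "\<bar>f x * g x\<bar> \<le> a * b" if "x \<in> space M" for x
    unfolding abs_mult using that by (intro mult_mono) (auto intro: order_trans[OF abs_ge_zero])
  then show ?thesis using assms by (auto simp: bounded_measurable_def)
qed

lemma prob_measures_space: "m \<in> prob_measures M \<Longrightarrow> space m = space M"
  by (intro sets_eq_imp_space_eq) (simp add: prob_measures_def)

lemma bounded_measurable_integrable:
  assumes m: "m \<in> prob_measures M" and f: "f \<in> bounded_measurable M"
  shows "integrable m f"
proof -
  interpret prob_space m using m by (simp add: prob_measures_def)
  have sets: "sets m = sets M" using m by (simp add: prob_measures_def)
  obtain a where "\<And>x. x \<in> space M \<Longrightarrow> \<bar>f x\<bar> \<le> a"
    using f by (auto simp: bounded_measurable_def)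
  then show ?thesis
    using f prob_measures_space[OF m]
    by (intro integrable_const_bound[where B=a])
       (auto simp: bounded_measurable_def measurable_cong_sets[OF sets refl])
qed

locale markov_kernel =
  fixes M :: "'a measure" and p :: "'a \<Rightarrow> 'a measure"
  assumes kernel: "p \<in> measurable M (prob_algebra M)"
begin

lemma kernel_prob_measure: "x \<in> space M \<Longrightarrow> p x \<in> prob_measures M"
  using measurable_space[OF kernel] by (auto simp: space_prob_algebra prob_measures_def)

lemma transition_op_bounded_measurable:
  assumes f: "f \<in> bounded_measurable M"
  shows "transition_op p f \<in> bounded_measurable M"
proof -
  have "p \<in> measurable M (subprob_algebra M)"
    using kernel by (rule measurable_prob_algebraD)
  moreover have "(\<lambda>n. \<integral>y. f y \<partial>n) \<in> borel_measurable (subprob_algebra M)"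
    using f by (intro integral_measurable_subprob_algebra) (auto simp: bounded_measurable_def)
  ultimately have "transition_op p f \<in> borel_measurable M"
    unfolding transition_op_def by (rule measurable_compose)
  moreover obtain a where a: "\<And>x. x \<in> space M \<Longrightarrow> \<bar>f x\<bar> \<le> a"
    using f by (auto simp: bounded_measurable_def)
  have "\<bar>transition_op p f x\<bar> \<le> a" if x: "x \<in> space M" for x
  proof -
    interpret prob_space "p x" using kernel_prob_measure[OF x] by (simp add: prob_measures_def)
    have sp: "space (p x) = space M"
      using kernel_prob_measure[OF x] by (rule prob_measures_space)
    have int: "integrable (p x) f"
      using kernel_prob_measure[OF x] f by (rule bounded_measurable_integrable)
    have "\<bar>transition_op p f x\<bar> \<le> (\<integral>y. \<bar>f y\<bar> \<partial>p x)"
      unfolding transition_op_def by (rule integral_abs_bound)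
    also have "\<dots> \<le> a" using int a by (intro integral_le_const) (auto simp: sp)
    finally show ?thesis .
  qed
  ultimately show ?thesis by (auto simp: bounded_measurable_def)
qed

lemma transition_op_one: "x \<in> space M \<Longrightarrow> transition_op p (\<lambda>_. 1) x = 1"
  using kernel_prob_measure[of x] prob_space.prob_space
  by (auto simp: transition_op_def prob_measures_def)

section \<open>Invariant and reversible measures\<close>

lemma reversible_measuresD:
  assumes m: "m \<in> reversible_measures M p"
    and f: "f \<in> bounded_measurable M" and g: "g \<in> bounded_measurable M"
  shows "(\<integral>x. transition_op p f x * g x \<partial>m) = (\<integral>x. f x * transition_op p g x \<partial>m)"
proof -
  have "\<forall>f\<in>bounded_measurable M. \<forall>g\<in>bounded_measurable M.
      (\<integral>x. transition_op p f x * g x \<partial>m) = (\<integral>x. f x * transition_op p g x \<partial>m)"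
    using m by (simp add: reversible_measures_def)
  from bspec[OF bspec[OF this f] g] show ?thesis .
qed

text \<open>Test the symmetry of the transition operator with \<open>g = 1\<close>, which it fixes.\<close>

lemma reversible_imp_invariant: "reversible_measures M p \<subseteq> invariant_measures M p"
proof
  fix m assume m: "m \<in> reversible_measures M p"
  then have sp: "space m = space M"
    by (auto simp: reversible_measures_def dest: prob_measures_space)
  have one: "(\<lambda>_. 1) \<in> bounded_measurable M" by (auto simp: bounded_measurable_def)
  have "(\<integral>x. transition_op p f x \<partial>m) = (\<integral>x. f x \<partial>m)" if f: "f \<in> bounded_measurable M" for f
  proof -
    have "(\<integral>x. transition_op p f x * 1 \<partial>m) = (\<integral>x. f x * transition_op p (\<lambda>_. 1) x \<partial>m)"
      using m f one by (rule reversible_measuresD)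
    also have "\<dots> = (\<integral>x. f x \<partial>m)"
      by (intro Bochner_Integration.integral_cong) (auto simp: transition_op_one sp)
    finally show ?thesis by simp
  qed
  then show "m \<in> invariant_measures M p"
    using m by (auto simp: invariant_measures_def reversible_measures_def)
qed

text \<open>
  The function \<open>D\<close> in the proof is the integrand of the Dirichlet form of \<open>h\<close>.  It is nonnegative
  and both invariance hypotheses together make its integral vanish.
\<close>

lemma invariant_density_constant_along_transitions:
  assumes m: "m \<in> invariant_measures M p"
    and h: "h \<in> bounded_measurable M" and h_nonneg: "\<And>x. 0 \<le> h x"
    and hm: "density m (\<lambda>x. ennreal (h x)) \<in> invariant_measures M p"
  shows "AE x in m. AE y in p x. h y = h x"
proof -
  let ?T = "transition_op p"
  have mP: "m \<in> prob_measures M" using m by (simp add: invariant_measures_def)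
  have sets_m: "sets m = sets M" using mP by (simp add: prob_measures_def)
  have sp: "space m = space M" using mP by (rule prob_measures_space)
  have meas: "f \<in> borel_measurable m" if "f \<in> bounded_measurable M" for f
    using that by (simp add: bounded_measurable_def measurable_cong_sets[OF sets_m refl])
  have integral_hm: "(\<integral>x. f x \<partial>density m (\<lambda>x. ennreal (h x))) = (\<integral>x. h x * f x \<partial>m)"
    if "f \<in> bounded_measurable M" for f
    using h_nonneg meas[OF that] meas[OF h] by (subst integral_density) auto
  have hh: "(\<lambda>x. h x * h x) \<in> bounded_measurable M" using h h by (rule bounded_measurable_mult)
  note Th = transition_op_bounded_measurable[OF h]
  note Thh = transition_op_bounded_measurable[OF hh]
  have hTh: "(\<lambda>x. h x * ?T h x) \<in> bounded_measurable M" using h Th by (rule bounded_measurable_mult)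
  note int = bounded_measurable_integrable[OF mP]
  define D where "D x = ?T (\<lambda>y. h y * h y) x - 2 * (h x * ?T h x) + h x * h x" for x
  have square: "integrable (p x) (\<lambda>y. (h y - h x)\<^sup>2)" "(\<integral>y. (h y - h x)\<^sup>2 \<partial>p x) = D x"
    if x: "x \<in> space M" for x
  proof -
    note px = kernel_prob_measure[OF x]
    interpret prob_space "p x" using px by (simp add: prob_measures_def)
    have i: "integrable (p x) h" "integrable (p x) (\<lambda>y. h y * h y)"
      using bounded_measurable_integrable[OF px] h hh by auto
    have eq: "(\<lambda>y. (h y - h x)\<^sup>2) = (\<lambda>y. h y * h y - 2 * h x * h y + h x * h x)"
      by (auto simp: power2_eq_square algebra_simps)
    show "integrable (p x) (\<lambda>y. (h y - h x)\<^sup>2)" unfolding eq using i by auto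
    show "(\<integral>y. (h y - h x)\<^sup>2 \<partial>p x) = D x"
      unfolding eq D_def transition_op_def using i by (simp add: prob_space)
  qed
  have "(\<integral>x. ?T (\<lambda>y. h y * h y) x \<partial>m) = (\<integral>x. h x * h x \<partial>m)"
    using m hh unfolding invariant_measures_def by blast
  moreover have "(\<integral>x. h x * ?T h x \<partial>m) = (\<integral>x. h x * h x \<partial>m)"
  proof -
    have "(\<integral>x. ?T h x \<partial>density m (\<lambda>x. ennreal (h x))) = (\<integral>x. h x \<partial>density m (\<lambda>x. ennreal (h x)))"
      using hm h unfolding invariant_measures_def by blast
    then show ?thesis by (simp add: integral_hm h Th)
  qed
  ultimately have "(\<integral>x. D x \<partial>m) = 0"
    using int[OF Thh] int[OF hTh] int[OF hh] by (simp add: D_def)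
  moreover have "integrable m D"
    using int[OF Thh] int[OF hTh] int[OF hh] by (simp add: D_def[abs_def])
  moreover have "AE x in m. 0 \<le> D x"
    by (rule AE_I2) (simp add: sp flip: square(2))
  ultimately have "AE x in m. D x = 0"
    using integral_nonneg_eq_0_iff_AE by blast
  with AE_space show ?thesis
  proof eventually_elim
    case (elim x)
    then have "x \<in> space M" by (simp add: sp)
    from square[OF this] elim have "AE y in p x. (h y - h x)\<^sup>2 = 0"
      by (subst (asm) (2) eq_commute) (subst integral_nonneg_eq_0_iff_AE[symmetric]; simp)
    then show ?case by simp
  qed
qed

text \<open>
  The density \<open>h\<close> does not change along transitions, so it passes through the transition operator
  like a constant.
\<close>

lemma transition_op_commutes_with_invariant_density:
  assumes m: "m \<in> invariant_measures M p"
    and h: "h \<in> bounded_measurable M" "\<And>x. 0 \<le> h x"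
    and hm: "density m (\<lambda>x. ennreal (h x)) \<in> invariant_measures M p"
    and g: "g \<in> bounded_measurable M"
  shows "AE x in m. transition_op p (\<lambda>y. h y * g y) x = h x * transition_op p g x"
  using invariant_density_constant_along_transitions[OF m h hm] AE_space
proof eventually_elim
  case (elim x)
  have "x \<in> space M"
    using m elim(2) by (auto simp: invariant_measures_def dest: prob_measures_space)
  then have "sets (p x) = sets M" using kernel_prob_measure by (simp add: prob_measures_def)
  then have [measurable]: "h \<in> borel_measurable (p x)" "g \<in> borel_measurable (p x)"
    using h g by (simp_all add: bounded_measurable_def cong: measurable_cong_sets)
  have "(\<integral>y. h y * g y \<partial>p x) = (\<integral>y. h x * g y \<partial>p x)"
    using elim(1) by (intro integral_cong_AE) auto
  then show ?case by (simp add: transition_op_def)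
qed

text \<open>
  Domination provides the bounded density \<open>h\<close>; moving \<open>h\<close> across the transition operator turns the
  symmetry relation for \<open>f\<close> and \<open>h g\<close> under \<open>m\<close> into the one for \<open>f\<close> and \<open>g\<close> under \<open>h m\<close>.
\<close>

lemma invariant_dominated_by_reversible:
  assumes m: "m \<in> reversible_measures M p" and n: "n \<in> invariant_measures M p"
    and c: "0 \<le> c" and dom: "\<And>E. E \<in> sets M \<Longrightarrow> measure n E \<le> c * measure m E"
  shows "n \<in> reversible_measures M p"
proof -
  let ?T = "transition_op p"
  have mP: "m \<in> prob_measures M" using m by (simp add: reversible_measures_def)
  have nP: "n \<in> prob_measures M" using n by (simp add: invariant_measures_def)
  have sets_m: "sets m = sets M" using mP by (simp add: prob_measures_def)
  have mI: "m \<in> invariant_measures M p" using m reversible_imp_invariant by blast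
  obtain h where hm: "h \<in> borel_measurable m" and h0: "\<And>x. 0 \<le> h x" and hc: "\<And>x. h x \<le> c"
    and n_eq: "n = density m (\<lambda>x. ennreal (h x))"
    using bounded_density_exists[of m n c] mP nP c dom
    by (auto simp: prob_measures_def prob_space_def)
  have h: "h \<in> bounded_measurable M"
    using hm h0 hc by (auto simp: bounded_measurable_def measurable_cong_sets[OF sets_m refl])
  have meas: "f \<in> borel_measurable m" if "f \<in> bounded_measurable M" for f
    using that by (simp add: bounded_measurable_def measurable_cong_sets[OF sets_m refl])
  have integral_n: "(\<integral>x. f x \<partial>n) = (\<integral>x. h x * f x \<partial>m)" if "f \<in> bounded_measurable M" for f
    unfolding n_eq using h0 meas[OF that] hm by (subst integral_density) auto
  have "(\<integral>x. ?T f x * g x \<partial>n) = (\<integral>x. f x * ?T g x \<partial>n)"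
    if f: "f \<in> bounded_measurable M" and g: "g \<in> bounded_measurable M" for f g
  proof -
    note Tf = transition_op_bounded_measurable[OF f]
    note Tg = transition_op_bounded_measurable[OF g]
    have hg: "(\<lambda>x. h x * g x) \<in> bounded_measurable M" using h g by (rule bounded_measurable_mult)
    note [measurable] = meas[OF transition_op_bounded_measurable[OF hg]] meas[OF Tg] meas[OF f] hm
    have "(\<integral>x. ?T f x * g x \<partial>n) = (\<integral>x. ?T f x * (h x * g x) \<partial>m)"
      by (simp add: integral_n bounded_measurable_mult Tf g mult.left_commute)
    also have "\<dots> = (\<integral>x. f x * ?T (\<lambda>x. h x * g x) x \<partial>m)"
      using m f hg by (rule reversible_measuresD)
    also have "\<dots> = (\<integral>x. f x * (h x * ?T g x) \<partial>m)"
    proof (rule integral_cong_AE)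
      show "AE x in m. f x * ?T (\<lambda>x. h x * g x) x = f x * (h x * ?T g x)"
        using transition_op_commutes_with_invariant_density[OF mI h h0 n[unfolded n_eq] g]
        by eventually_elim simp
    qed auto
    also have "\<dots> = (\<integral>x. f x * ?T g x \<partial>n)"
      by (simp add: integral_n bounded_measurable_mult f Tg mult.left_commute)
    finally show ?thesis .
  qed
  then show ?thesis using nP by (simp add: reversible_measures_def)
qed

lemma extreme_reversible_subset_extreme_invariant:
  "extreme_elements M (reversible_measures M p) \<subseteq> extreme_elements M (invariant_measures M p)"
proof
  fix m assume m: "m \<in> extreme_elements M (reversible_measures M p)"
  then have mR: "m \<in> reversible_measures M p" by (simp add: extreme_elements_def)
  have "m0 = m1"
    if t: "0 < t" "t < 1"
      and m0: "m0 \<in> invariant_measures M p" and m1: "m1 \<in> invariant_measures M p"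
      and mix: "\<forall>E\<in>sets M. measure m E = (1 - t) * measure m0 E + t * measure m1 E"
    for t :: real and m0 m1
  proof -
    have dom: "(1 - t) * measure m0 E \<le> measure m E" "t * measure m1 E \<le> measure m E"
      if "E \<in> sets M" for E
      using mix that t by simp_all
    have "m0 \<in> reversible_measures M p"
      using mR m0
      by (rule invariant_dominated_by_reversible[where c = "1 / (1 - t)"])
         (use t dom(1) in \<open>simp_all add: pos_le_divide_eq mult.commute\<close>)
    moreover have "m1 \<in> reversible_measures M p"
      using mR m1
      by (rule invariant_dominated_by_reversible[where c = "1 / t"])
         (use t dom(2) in \<open>simp_all add: pos_le_divide_eq mult.commute\<close>)
    ultimately show ?thesis
      using m t mix unfolding extreme_elements_def by blast
  qed
  then show "m \<in> extreme_elements M (invariant_measures M p)"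
    using mR reversible_imp_invariant unfolding extreme_elements_def by blast
qed

end

section \<open>The transition function of a conservative Markov process\<close>

lemma (in markov_process) markov_kernel_transition:
  assumes "conservative M (transition M P \<eta>)"
  shows "markov_kernel M (transition M P \<eta>)"
proof
  have prob: "prob_space (transition M P \<eta> x)" if "x \<in> space M" for x
    using assms that by (intro prob_spaceI) (simp add: conservative_def)
  have "transition M P \<eta> \<in> measurable M (subprob_algebra M)"
    by (rule measurable_subprob_algebra)
       (auto intro: prob prob_space_imp_subprob_space measurable_transition)
  with prob show "transition M P \<eta> \<in> measurable M (prob_algebra M)"
    by (intro measurable_prob_algebraI) auto
qed

theorem theorem4:
  fixes M :: "'a measure" and W :: "'w measure"
    and P :: "'a \<Rightarrow> 'w measure" and \<eta> :: "nat \<Rightarrow> 'w \<Rightarrow> 'a option"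
  assumes "markov_process M W P \<eta>"
    and "conservative M (transition M P \<eta>)"
  shows "extreme_elements M (reversible_measures M (transition M P \<eta>))
      \<subseteq> extreme_elements M (invariant_measures M (transition M P \<eta>))"
  using markov_process.markov_kernel_transition[OF assms]
  by (rule markov_kernel.extreme_reversible_subset_extreme_invariant)

end
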